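(* Fix an integer $d\ge 1$. Let $g(m,d)$ denote the minimum size of a subset of $Q_m=\{0,1\}^m$ which intersects every $d$-dimensional subcube of $Q_m$, and suppose that $$\gamma_d=\lim_{m\to\infty}\frac{g(m,d)}{2^m}$$ exists. Then, as $n\to\infty$, $$N(n,n-d-1)=(\gamma_d+o(1))\,n!.$$ Equivalently, writing $t=d+1$, $N(n,n-t)=(\gamma_{t-1}+o(1))\,n!$ for every fixed $t\ge 2$.
   Context: $B_n=2^{[n]}$ is the Boolean lattice of all subsets of $[n]=\{1,\dots,n\}$ ordered by inclusion. A chain is a set of pairwise comparable elements; a chain $C$ covers a chain $D$ if $D\subseteq C$. For $1\le r\le n+1$, $N(n,r)$ is the least number of chains in $B_n$ such that every strict chain $F_1\subset F_2\subset\cdots\subset F_r$ of size $r$ in $B_n$ is covered by at least one of them. A $d$-dimensional subcube of $Q_m=\{0,1\}^m$ is a set of $2^d$ points obtained by choosing $d$ coordinates that vary freely and fixing the values of the remaining $m-d$ coordinates. The $o(1)$ term tends to $0$ as $n\to\infty$ with $d$ (respectively $t$) fixed. *)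

theory Defs
  imports Complex_Main "HOL-Library.FuncSet" "HOL-Library.Landau_Symbols"
begin

definition boolean_lattice :: "nat \<Rightarrow> nat set set" where
  "boolean_lattice n = Pow {1..n}"

text \<open>A strict chain \<open>F\<^sub>1 \<subset> \<dots> \<subset> F\<^sub>r\<close>, as a set of \<open>r\<close> elements.\<close>

definition strict_chain :: "nat \<Rightarrow> nat \<Rightarrow> nat set set \<Rightarrow> bool" where
  "strict_chain n r D \<longleftrightarrow>
     (\<exists>F. F ` {1..r} \<subseteq> boolean_lattice n \<and> strict_mono_on {1..r} F \<and> D = F ` {1..r})"

definition chain_cover :: "nat \<Rightarrow> nat \<Rightarrow> nat set set set \<Rightarrow> bool" where
  "chain_cover n r \<C> \<longleftrightarrow>
     (\<forall>C\<in>\<C>. subset.chain (boolean_lattice n) C) \<and>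
     (\<forall>D. strict_chain n r D \<longrightarrow> (\<exists>C\<in>\<C>. D \<subseteq> C))"

text \<open>Intended for \<open>1 \<le> r \<le> n + 1\<close>. The minimum ranges over a nonempty set: the family
  of all chains is a cover, and every cover is a finite set.\<close>

definition chain_cover_number :: "nat \<Rightarrow> nat \<Rightarrow> nat" where
  "chain_cover_number n r = (LEAST k. \<exists>\<C>. chain_cover n r \<C> \<and> card \<C> = k)"

definition cube :: "nat \<Rightarrow> (nat \<Rightarrow> nat) set" where
  "cube m = {1..m} \<rightarrow>\<^sub>E {0, 1}"

text \<open>\<open>I\<close> is the set of free coordinates; \<open>a\<close> supplies the values of the fixed ones.\<close>

definition is_subcube :: "nat \<Rightarrow> nat \<Rightarrow> (nat \<Rightarrow> nat) set \<Rightarrow> bool" where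
  "is_subcube m d A \<longleftrightarrow>
     (\<exists>I a. I \<subseteq> {1..m} \<and> card I = d \<and> a \<in> cube m \<and>
        A = {x \<in> cube m. \<forall>i\<in>{1..m} - I. x i = a i})"

definition subcube_hitting_number :: "nat \<Rightarrow> nat \<Rightarrow> nat" where
  "subcube_hitting_number m d =
     (LEAST k. \<exists>S. S \<subseteq> cube m \<and> (\<forall>A. is_subcube m d A \<longrightarrow> S \<inter> A \<noteq> {}) \<and> card S = k)"

definition hitting_ratio :: "nat \<Rightarrow> nat \<Rightarrow> real" where
  "hitting_ratio d m = real (subcube_hitting_number m d) / 2 ^ m"

text \<open>Only meaningful if \<open>hitting_ratio d\<close> converges.\<close>

definition hitting_density :: "nat \<Rightarrow> real" where
  "hitting_density d = lim (hitting_ratio d)"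

end

theory Submission
  imports Defs "HOL-Library.Infinite_Set" "HOL-Combinatorics.Multiset_Permutations"
begin

text \<open>
  Write \<open>g(m, d)\<close> for the least size of a set that meets every \<open>d\<close>-dimensional subcube of \<open>Q\<^sub>m\<close>.
  The theorem follows, by sandwiching, from the two inequalities, valid for \<open>n \<ge> d + 1\<close>,

    \<open>g(\<lfloor>n/2\<rfloor>, d) / 2^\<lfloor>n/2\<rfloor> \<le> N(n, n - d - 1) / n! \<le> g(n, d) / 2^n\<close>.

  A maximal chain of \<open>B\<^sub>n\<close> is the set of prefixes of a permutation of \<open>[n]\<close>. Every chain extends to a
  maximal one, so a cover is essentially a set of permutations, written here as lists. Both
  inequalities compare the set of permutations with a Boolean cube and then average.

  \<^emph>\<open>Lower bound\<close> (\<open>chain_cover_number_lower\<close>). Let \<open>m = \<lfloor>n/2\<rfloor>\<close> and let \<open>Q\<^sub>m\<close> act on permutations by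
  exchanging, for each coordinate \<open>j\<close> with value 1, the entries at positions \<open>2j - 1\<close> and \<open>2j\<close>.
  An orbit is a copy of \<open>Q\<^sub>m\<close>. Take a permutation and delete from its chain the empty set, the full
  set and the levels \<open>2i - 1\<close> for \<open>d\<close> chosen indices \<open>i\<close>. The permutations whose chains cover the
  remaining \<open>n - d - 1\<close> sets form exactly a \<open>d\<close>-subcube of the orbit. A cover thus has at least
  \<open>g(m, d)\<close> elements in each orbit.

  \<^emph>\<open>Upper bound\<close> (\<open>chain_cover_number_upper\<close>). To a permutation assign the point of \<open>Q\<^sub>n\<close> whose
  coordinate \<open>a\<close> is the parity of the number of elements larger than \<open>a\<close> that precede \<open>a\<close>, i.e. the
  Lehmer code modulo 2. A chain \<open>D\<close> of size \<open>n - d - 1\<close> splits \<open>[n]\<close> into at most \<open>n - d\<close> ordered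
  blocks, and it is covered by the permutations that list the blocks in this order. The key point
  is that their codes fill a whole subcube, whose free coordinates are the elements that are not
  the largest of their block; there are at least \<open>d\<close> of those. This holds for blocks of any size:
  inserting the elements from the largest to the smallest, each element may be put at the very
  beginning of its block or one place later, and it does not disturb the coordinates fixed before
  (\<open>linear_extension_with_lehmer_parities\<close>). Hence the permutations whose code lies in a set \<open>H\<close>
  meeting all \<open>d\<close>-subcubes cover everything. Codes are not equidistributed in \<open>Q\<^sub>n\<close>, but \<open>H\<close> may be
  replaced by any of its translates, and for an average translate the number of such
  permutations is \<open>n! |H| / 2^n\<close>.
\<close>

section \<open>Cubes and sets that hit all subcubes\<close>

lemma sum_card_swap:
  assumes "finite S" "finite P"
  shows "(\<Sum>s\<in>S. card {x \<in> P. R s x}) = (\<Sum>x\<in>P. card {s \<in> S. R s x})"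
  using sum.swap_restrict[OF assms, of "\<lambda>_ _. 1::nat" R] by simp

lemma cube_eqI:
  assumes "x \<in> cube m" "y \<in> cube m" "\<And>i. i \<in> {1..m} \<Longrightarrow> x i = y i"
  shows "x = y"
  using assms unfolding cube_def by (meson PiE_ext)

lemma cube_less_2: "x \<in> cube m \<Longrightarrow> i \<in> {1..m} \<Longrightarrow> x i < 2"
  unfolding cube_def by (force dest: PiE_mem)

lemma restrict_cube: "(\<And>i. i \<in> {1..m} \<Longrightarrow> x i < 2) \<Longrightarrow> restrict x {1..m} \<in> cube m"
  unfolding cube_def by (auto simp: less_2_cases_iff)

lemma finite_cube: "finite (cube m)"
  unfolding cube_def by (intro finite_PiE) auto

lemma card_cube: "card (cube m) = 2 ^ m"
  unfolding cube_def by (simp add: card_PiE numeral_2_eq_2)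

definition hits_subcubes :: "nat \<Rightarrow> nat \<Rightarrow> (nat \<Rightarrow> nat) set \<Rightarrow> bool" where
  "hits_subcubes m d S \<longleftrightarrow> S \<subseteq> cube m \<and> (\<forall>A. is_subcube m d A \<longrightarrow> S \<inter> A \<noteq> {})"

lemma hits_subcubesD:
  assumes "hits_subcubes m d S" "I \<subseteq> {1..m}" "card I = d" "a \<in> cube m"
  obtains x where "x \<in> S" "x \<in> cube m" "\<And>i. i \<in> {1..m} - I \<Longrightarrow> x i = a i"
proof -
  have "is_subcube m d {x \<in> cube m. \<forall>i\<in>{1..m} - I. x i = a i}"
    unfolding is_subcube_def using assms by blast
  with assms(1) have "S \<inter> {x \<in> cube m. \<forall>i\<in>{1..m} - I. x i = a i} \<noteq> {}"
    unfolding hits_subcubes_def by blast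
  with that show ?thesis by blast
qed

lemma hits_subcubes_cube: "hits_subcubes m d (cube m)"
  unfolding hits_subcubes_def is_subcube_def by blast

lemma minimum_hitting_set:
  obtains S where "hits_subcubes m d S" "card S = subcube_hitting_number m d"
proof -
  have "\<exists>k S. S \<subseteq> cube m \<and> (\<forall>A. is_subcube m d A \<longrightarrow> S \<inter> A \<noteq> {}) \<and> card S = k"
    using hits_subcubes_cube[of m d] unfolding hits_subcubes_def by blast
  from LeastI_ex[OF this] show ?thesis
    using that unfolding hits_subcubes_def subcube_hitting_number_def by blast
qed

lemma subcube_hitting_number_le: "hits_subcubes m d S \<Longrightarrow> subcube_hitting_number m d \<le> card S"
  unfolding subcube_hitting_number_def hits_subcubes_def by (intro Least_le) blast

section \<open>Chains and permutations\<close>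

text \<open>The maximal chain of a permutation, including the empty and the full set.\<close>

definition prefixes :: "nat list \<Rightarrow> nat set set" where
  "prefixes xs = range (\<lambda>k. set (take k xs))"

lemma prefixes_chain:
  assumes "xs \<in> permutations_of_set {1..n}"
  shows "subset.chain (boolean_lattice n) (prefixes xs)"
proof -
  have "set (take k xs) \<subseteq> {1..n}" for k
    using set_take_subset[of k xs] permutations_of_setD(1)[OF assms] by simp
  moreover have "set (take j xs) \<subseteq> set (take k xs) \<or> set (take k xs) \<subseteq> set (take j xs)" for j k
    using set_take_subset_set_take[of j k xs] set_take_subset_set_take[of k j xs] by linarith
  ultimately show ?thesis
    unfolding subset_chain_def prefixes_def boolean_lattice_def by blast
qed

lemma prefix_eq_take_card:
  assumes "distinct xs" "X \<in> prefixes xs"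
  shows "X = set (take (card X) xs)"
proof -
  obtain k where X: "X = set (take k xs)" using assms(2) unfolding prefixes_def by blast
  hence "card X = min (length xs) k" using assms(1) by (simp add: distinct_card)
  thus ?thesis using X by (cases "k \<le> length xs") auto
qed

text \<open>A chain induces a total preorder on the ground set: elements that enter the chain earlier
  have smaller depth. The level sets of \<open>depth D\<close> are the ordered blocks into which \<open>D\<close> cuts
  the ground set.\<close>

definition depth :: "nat set set \<Rightarrow> nat \<Rightarrow> nat" where
  "depth D x = card {X \<in> D. x \<notin> X}"

lemma depth_less:
  assumes "subset.chain A D" "finite D" "X \<in> D" "x \<in> X" "y \<notin> X"
  shows "depth D x < depth D y"
proof -
  have "{Z \<in> D. x \<notin> Z} \<subset> {Z \<in> D. y \<notin> Z}"
    using assms(1,3-5) unfolding subset_chain_def by blast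
  thus ?thesis unfolding depth_def using assms(2) by (intro psubset_card_mono) auto
qed

text \<open>Each member of \<open>D\<close> is an initial segment of the preorder, so every linear extension of the
  preorder has it as a prefix.\<close>

lemma chain_subset_prefixes:
  assumes chain: "subset.chain (boolean_lattice n) D" and fin: "finite D"
    and xs: "set xs = {1..n}" and srt: "sorted (map (depth D) xs)"
  shows "D \<subseteq> prefixes xs"
proof
  fix X assume X: "X \<in> D"
  have sub: "X \<subseteq> set xs"
    using chain X xs unfolding subset_chain_def boolean_lattice_def by blast
  define us where "us = takeWhile (\<lambda>x. x \<in> X) xs"
  define vs where "vs = dropWhile (\<lambda>x. x \<in> X) xs"
  have dec: "xs = us @ vs" by (simp add: us_def vs_def)
  have "set us \<subseteq> X" unfolding us_def using set_takeWhileD by fastforce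
  moreover have "X \<inter> set vs = {}"
  proof (cases vs)
    case (Cons v vs')
    hence v: "v \<notin> X" unfolding vs_def by (metis hd_dropWhile list.sel(1) list.distinct(1))
    have "depth D v \<le> depth D w" if "w \<in> set vs" for w
      using srt that unfolding dec Cons by (auto simp: sorted_append)
    thus ?thesis using depth_less[OF chain fin X _ v] by fastforce
  qed simp
  ultimately have "X = set us" using sub unfolding dec by auto
  also have "us = take (length us) xs" by (simp add: dec)
  finally show "X \<in> prefixes xs" unfolding prefixes_def by blast
qed

lemma chain_extends_to_permutation:
  assumes "subset.chain (boolean_lattice n) C"
  obtains xs where "xs \<in> permutations_of_set {1..n}" "C \<subseteq> prefixes xs"
proof
  have "finite C"
    using assms unfolding subset_chain_def boolean_lattice_def
    by (meson finite_Pow_iff finite_atLeastAtMost finite_subset)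
  thus "C \<subseteq> prefixes (sort_key (depth C) [1..<Suc n])"
    using assms by (intro chain_subset_prefixes) auto
  show "sort_key (depth C) [1..<Suc n] \<in> permutations_of_set {1..n}"
    by (intro permutations_of_setI) auto
qed

text \<open>The next two lemmas translate between indexed strict chains and plain sets of sets.\<close>

lemma strict_chainD:
  assumes "strict_chain n r D"
  shows "subset.chain (boolean_lattice n) D" "finite D" "card D = r"
proof -
  obtain F where F: "F ` {1..r} \<subseteq> boolean_lattice n" "strict_mono_on {1..r} F" "D = F ` {1..r}"
    using assms unfolding strict_chain_def by blast
  show "finite D" using F by simp
  show "card D = r" using F by (simp add: card_image strict_mono_on_imp_inj_on)
  have "F i \<subseteq> F j \<or> F j \<subseteq> F i" if "i \<in> {1..r}" "j \<in> {1..r}" for i j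
    using F(2) that by (metis linorder_less_linear order_refl psubset_imp_subset strict_mono_onD)
  thus "subset.chain (boolean_lattice n) D" using F unfolding subset_chain_def by blast
qed

lemma strict_chain_prefixes:
  assumes xs: "xs \<in> permutations_of_set {1..n}" and K: "K \<subseteq> {..n}" and r: "card K = r"
  shows "strict_chain n r ((\<lambda>k. set (take k xs)) ` K)"
proof -
  have fin: "finite K" using K by (rule finite_subset) simp
  obtain h where h: "bij_betw h {..<card K} K" "strict_mono_on {..<card K} h"
    by (rule ex_bij_betw_strict_mono_card[OF fin])
  define F where "F i = set (take (h (i - 1)) xs)" for i
  have dist: "distinct xs" and set: "set xs = {1..n}" and len: "length xs = n"
    using permutations_of_setD[OF xs] distinct_card[of xs] by auto
  have "(\<lambda>i. i - 1) ` {1..r} = {..<r}"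
    by (simp only: image_Suc_lessThan[symmetric] image_image) simp
  hence "F ` {1..r} = (\<lambda>k. set (take k xs)) ` h ` {..<r}"
    unfolding F_def by (metis (no_types, lifting) image_cong image_image)
  hence im: "F ` {1..r} = (\<lambda>k. set (take k xs)) ` K"
    using h(1) r by (simp add: bij_betw_def)
  have "strict_mono_on {1..r} F"
  proof (rule strict_mono_onI)
    fix i j assume ij: "i \<in> {1..r}" "j \<in> {1..r}" "i < j"
    hence "h (i - 1) < h (j - 1)" using h(2) r by (intro strict_mono_onD[of _ h]) auto
    moreover have "h (j - 1) \<le> n" 
      using h(1) K r ij(2) unfolding bij_betw_def by fastforce
    ultimately have "card (F i) < card (F j)" "F i \<subseteq> F j"
      unfolding F_def using dist len by (simp_all add: distinct_card set_take_subset_set_take)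
    thus "F i < F j" by auto
  qed
  moreover have "F ` {1..r} \<subseteq> boolean_lattice n"
    unfolding F_def boolean_lattice_def using set by (auto dest: in_set_takeD)
  ultimately show ?thesis unfolding strict_chain_def im[symmetric] by blast
qed

section \<open>Lehmer codes of linear extensions\<close>

definition lehmer :: "nat list \<Rightarrow> nat \<Rightarrow> nat" where
  "lehmer xs a = length (filter (\<lambda>b. a < b) (takeWhile (\<lambda>b. b \<noteq> a) xs))"

text \<open>Since \<open>lehmer xs b\<close> counts larger elements only, inserting a smaller one leaves it alone.
  This makes the entries of the code independent when elements are inserted in decreasing order.\<close>

lemma lehmer_insert_smaller:
  assumes "a < b" "b \<in> set (us @ vs)"
  shows "lehmer (us @ a # vs) b = lehmer (us @ vs) b"
  using assms unfolding lehmer_def by (auto simp: takeWhile_append)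

lemma lehmer_smallest:
  assumes "\<forall>c\<in>set us. a < c"
  shows "lehmer (us @ a # vs) a = length us"
proof -
  have "takeWhile (\<lambda>b. b \<noteq> a) (us @ a # vs) = us" 
    using assms by (subst takeWhile_append2) auto
  thus ?thesis using assms unfolding lehmer_def by simp
qed

text \<open>The linear extensions of an ordered partition realise every parity vector, except that an
  element which is the largest of its block has a forced parity: the larger elements before it
  are exactly those in earlier blocks. For any other element \<open>a\<close>, inserted after all larger
  elements, the first two places inside its block give consecutive values of the code, so one of
  them has the required parity.\<close>

lemma linear_extension_with_lehmer_parities:
  fixes key :: "nat \<Rightarrow> nat"
  assumes "finite S" "\<And>a. a \<in> S \<Longrightarrow> y a < 2"
    and "\<And>a. a \<in> S \<Longrightarrow> (\<forall>b\<in>S. a < b \<longrightarrow> key b \<noteq> key a) \<Longrightarrow>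
              y a = card {b \<in> S. a < b \<and> key b < key a} mod 2"
  shows "\<exists>xs\<in>permutations_of_set S. sorted (map key xs) \<and> (\<forall>a\<in>S. lehmer xs a mod 2 = y a)"
  using assms
proof (induction S rule: finite_linorder_min_induct)
  case (insert a S)
  have eqs: "{b \<in> insert a S. c < b \<and> key b < key c} = {b \<in> S. c < b \<and> key b < key c}" if "c \<in> S" for c
    using insert.hyps(2) that by fastforce
  have "\<exists>xs\<in>permutations_of_set S. sorted (map key xs) \<and> (\<forall>c\<in>S. lehmer xs c mod 2 = y c)"
  proof (rule insert.IH)
    fix c assume c: "c \<in> S" "\<forall>b\<in>S. c < b \<longrightarrow> key b \<noteq> key c"
    hence "\<forall>b\<in>insert a S. c < b \<longrightarrow> key b \<noteq> key c" using insert.hyps(2) by fastforce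
    thus "y c = card {b \<in> S. c < b \<and> key b < key c} mod 2"
      using insert.prems(2)[of c] c(1) eqs by simp
  qed (use insert.prems(1) in auto)
  then obtain xs where xs: "distinct xs" "set xs = S" "sorted (map key xs)"
    "\<And>c. c \<in> S \<Longrightarrow> lehmer xs c mod 2 = y c"
    by (auto dest: permutations_of_setD)
  define us where "us = takeWhile (\<lambda>x. key x < key a) xs"
  define vs where "vs = dropWhile (\<lambda>x. key x < key a) xs"
  have dec: "xs = us @ vs" by (simp add: us_def vs_def)
  have us: "\<forall>x\<in>set us. key x < key a" unfolding us_def using set_takeWhileD by fastforce
  have vs: "\<forall>x\<in>set vs. key a \<le> key x"
  proof (cases vs)
    case (Cons v vs')
    hence "key a \<le> key v" unfolding vs_def by (metis hd_dropWhile list.sel(1) list.distinct(1) not_le)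
    thus ?thesis using xs(3) unfolding dec Cons by (auto simp: sorted_append)
  qed simp
  have "{b \<in> insert a S. a < b \<and> key b < key a} = set us"
    using us vs insert.hyps(2) xs(2) unfolding dec by fastforce
  hence cnt: "card {b \<in> insert a S. a < b \<and> key b < key a} = length us"
    using xs(1) unfolding dec by (simp add: distinct_card)
  \<comment> \<open>Any insertion place that respects the blocks and leaves the right number of elements in front
      is good enough.\<close>
  have good: ?case if split: "xs = ps @ qs" and par: "length ps mod 2 = y a"
    and srt: "sorted (map key (ps @ a # qs))" for ps qs
  proof (intro bexI conjI ballI)
    show "ps @ a # qs \<in> permutations_of_set (insert a S)"
      using xs(1,2) insert.hyps(2) unfolding split by (intro permutations_of_setI) auto
    fix c assume c: "c \<in> insert a S"
    show "lehmer (ps @ a # qs) c mod 2 = y c"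
    proof (cases "c = a")
      case True
      have "lehmer (ps @ a # qs) a = length ps"
        using insert.hyps(2) xs(2) unfolding split by (intro lehmer_smallest) auto
      with True par show ?thesis by simp
    next
      case False
      with c insert.hyps(2) have "c \<in> S" "a < c" by auto
      thus ?thesis using lehmer_insert_smaller[of a c ps qs] xs(2,4) unfolding split by auto
    qed
  qed (fact srt)
  show ?case
  proof (cases "length us mod 2 = y a")
    case True
    thus ?thesis using us vs xs(3) by (intro good[OF dec]) (auto simp: dec sorted_append less_imp_le)
  next
    case False
    \<comment> \<open>The front of the block has the wrong parity, so \<open>a\<close> is not the largest element of its block
        and can be moved behind one more element \<open>v\<close> of the block.\<close>
    hence "\<not> (\<forall>b\<in>insert a S. a < b \<longrightarrow> key b \<noteq> key a)"
      using insert.prems(2)[of a] cnt by auto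
    then obtain b where b: "b \<in> S" "key b = key a" by auto
    hence "b \<in> set vs" using xs(2) us unfolding dec by auto
    then obtain v vs' where v: "vs = v # vs'" by (cases vs) auto
    have "key v \<le> key b" using \<open>b \<in> set vs\<close> xs(3) unfolding dec v by (auto simp: sorted_append)
    hence kv: "key v = key a" using b(2) vs v by auto
    have "length (us @ [v]) mod 2 = y a"
      using False insert.prems(1)[of a] by (simp add: mod_Suc)
    thus ?thesis using us vs xs(3) kv
      by (intro good[of "us @ [v]" vs']) (auto simp: dec v sorted_append less_imp_le)
  qed
qed simp

section \<open>The upper bound\<close>

text \<open>A chain \<open>D\<close> cuts the ground set into at most \<open>card D + 1\<close> blocks, and each block has one
  maximum. All other elements will give free coordinates.\<close>

lemma few_class_maxima:
  assumes "finite D"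
  shows "card {a \<in> {1..n}. \<forall>b\<in>{1..n}. a < b \<longrightarrow> depth D b \<noteq> depth D a} \<le> card D + 1"
proof -
  let ?M = "{a \<in> {1..n}. \<forall>b\<in>{1..n}. a < b \<longrightarrow> depth D b \<noteq> depth D a}"
  have "inj_on (depth D) ?M"
    by (rule inj_onI) (metis (mono_tags, lifting) linorder_neqE_nat mem_Collect_eq)
  moreover have "depth D ` ?M \<subseteq> {..card D}"
    unfolding depth_def using assms by (auto intro!: card_mono)
  ultimately show ?thesis using card_inj_on_le[of "depth D" ?M "{..card D}"] by simp
qed

definition shifted_code :: "nat \<Rightarrow> (nat \<Rightarrow> nat) \<Rightarrow> nat list \<Rightarrow> nat \<Rightarrow> nat" where
  "shifted_code n s xs = (\<lambda>a\<in>{1..n}. (lehmer xs a + s a) mod 2)"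

lemma add_mod_2_cancel: "(s::nat) < 2 \<Longrightarrow> t < 2 \<Longrightarrow> (l + s) mod 2 = (l + t) mod 2 \<Longrightarrow> s = t"
  by presburger

lemma inj_on_shifted_code: "inj_on (\<lambda>s. shifted_code n s xs) (cube n)"
proof (rule inj_onI)
  fix s t assume s: "s \<in> cube n" and t: "t \<in> cube n" and eq: "shifted_code n s xs = shifted_code n t xs"
  show "s = t"
  proof (rule cube_eqI[OF s t])
    fix i assume i: "i \<in> {1..n}"
    with fun_cong[OF eq, of i] have "(lehmer xs i + s i) mod 2 = (lehmer xs i + t i) mod 2"
      by (simp add: shifted_code_def)
    with cube_less_2[OF s i] cube_less_2[OF t i] show "s i = t i" by (rule add_mod_2_cancel)
  qed
qed

text \<open>For a fixed permutation the shifted codes are pairwise distinct, so at most \<open>card H\<close> shifts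
  send it into \<open>H\<close>. Averaging over the \<open>2 ^ n\<close> shifts gives the bound.\<close>

lemma exists_good_shift:
  assumes "finite H"
  obtains s where "s \<in> cube n"
    "2 ^ n * card {xs \<in> permutations_of_set {1..n}. shifted_code n s xs \<in> H} \<le> fact n * card H"
proof -
  let ?P = "permutations_of_set {1..n}" and ?R = "\<lambda>s xs. shifted_code n s xs \<in> H"
  have "card {s \<in> cube n. ?R s xs} \<le> card H" for xs
    by (rule card_inj_on_le[of "\<lambda>s. shifted_code n s xs"])
       (use assms inj_on_shifted_code in \<open>auto intro: inj_on_subset\<close>)
  hence "(\<Sum>xs\<in>?P. card {s \<in> cube n. ?R s xs}) \<le> card ?P * card H"
    using sum_bounded_above[of ?P "\<lambda>xs. card {s \<in> cube n. ?R s xs}" "card H"] by simp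
  hence le: "(\<Sum>s\<in>cube n. card {xs \<in> ?P. ?R s xs}) \<le> fact n * card H"
    by (subst sum_card_swap) (auto simp: finite_cube)
  have "\<exists>s\<in>cube n. 2 ^ n * card {xs \<in> ?P. ?R s xs} \<le> fact n * card H"
  proof (rule ccontr)
    assume "\<not> ?thesis"
    hence "(\<Sum>s\<in>cube n. fact n * card H) < (\<Sum>s\<in>cube n. 2 ^ n * card {xs \<in> ?P. ?R s xs})"
      by (intro sum_strict_mono) (use card_cube[of n] finite_cube in \<open>force simp: not_le\<close>)+
    also have "\<dots> = 2 ^ n * (\<Sum>s\<in>cube n. card {xs \<in> ?P. ?R s xs})"
      by (simp add: sum_distrib_left)
    also have "\<dots> \<le> 2 ^ n * (fact n * card H)" using le by simp
    finally show False by (simp add: card_cube)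
  qed
  with that show ?thesis by blast
qed

lemma strict_chain_covered_by_coded_permutation:
  assumes n: "d + 1 \<le> n" and H: "hits_subcubes n d H" and s: "s \<in> cube n"
    and D: "strict_chain n (n - d - 1) D"
  shows "\<exists>xs\<in>permutations_of_set {1..n}. shifted_code n s xs \<in> H \<and> D \<subseteq> prefixes xs"
proof -
  note D' = strict_chainD[OF D]
  let ?M = "{a \<in> {1..n}. \<forall>b\<in>{1..n}. a < b \<longrightarrow> depth D b \<noteq> depth D a}"
  have "card ?M \<le> n - d" using few_class_maxima[OF D'(2), of n] D'(3) n by simp
  moreover have "card ({1..n} - ?M) = n - card ?M" by (subst card_Diff_subset) auto
  ultimately have "d \<le> card ({1..n} - ?M)" using n by simp
  \<comment> \<open>A subcube of dimension exactly \<open>d\<close> is enough; surplus free coordinates are frozen at the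
      value prescribed for block maxima, which is one of the attainable values.\<close>
  then obtain I where I: "I \<subseteq> {1..n} - ?M" "card I = d" by (meson obtain_subset_with_card_n)
  define c where "c a = card {b \<in> {1..n}. a < b \<and> depth D b < depth D a}" for a
  have "(\<lambda>a\<in>{1..n}. (c a + s a) mod 2) \<in> cube n" by (intro restrict_cube) simp
  then obtain h where h: "h \<in> H" "h \<in> cube n"
      "\<And>a. a \<in> {1..n} - I \<Longrightarrow> h a = (\<lambda>a\<in>{1..n}. (c a + s a) mod 2) a"
    using hits_subcubesD[OF H _ I(2)] I(1) by blast
  \<comment> \<open>Translation by \<open>s\<close> is its own inverse modulo 2: \<open>y\<close> is the unshifted code that goes to \<open>h\<close>.\<close>
  define y where "y a = (h a + s a) mod 2" for a
  have "\<exists>xs\<in>permutations_of_set {1..n}. sorted (map (depth D) xs) \<and>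
          (\<forall>a\<in>{1..n}. lehmer xs a mod 2 = y a)"
  proof (rule linear_extension_with_lehmer_parities)
    fix a assume a: "a \<in> {1..n}" "\<forall>b\<in>{1..n}. a < b \<longrightarrow> depth D b \<noteq> depth D a"
    hence "h a = (c a + s a) mod 2" using h(3)[of a] I(1) by auto
    hence "y a = c a mod 2" unfolding y_def by presburger
    thus "y a = card {b \<in> {1..n}. a < b \<and> depth D b < depth D a} mod 2" by (simp add: c_def)
  qed (simp_all add: y_def)
  then obtain xs where xs: "xs \<in> permutations_of_set {1..n}" "sorted (map (depth D) xs)"
    "\<And>a. a \<in> {1..n} \<Longrightarrow> lehmer xs a mod 2 = y a" by blast
  have "shifted_code n s xs = h"
  proof (rule cube_eqI[OF _ h(2)])
    show "shifted_code n s xs \<in> cube n" unfolding shifted_code_def by (intro restrict_cube) simp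
    fix a assume a: "a \<in> {1..n}"
    have "(lehmer xs a + s a) mod 2 = h a"
      using xs(3)[OF a] cube_less_2[OF h(2) a] unfolding y_def by presburger
    thus "shifted_code n s xs a = h a" using a by (simp add: shifted_code_def)
  qed
  moreover have "D \<subseteq> prefixes xs"
    using xs(1,2) D' by (intro chain_subset_prefixes) (auto dest: permutations_of_setD)
  ultimately show ?thesis using xs(1) h(1) by blast
qed

lemma exists_economical_cover:
  assumes "d + 1 \<le> n"
  obtains \<C> where "chain_cover n (n - d - 1) \<C>"
    "2 ^ n * card \<C> \<le> fact n * subcube_hitting_number n d"
proof -
  obtain H where H: "hits_subcubes n d H" "card H = subcube_hitting_number n d"
    by (rule minimum_hitting_set)
  have "H \<subseteq> cube n" using H(1) unfolding hits_subcubes_def by blast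
  hence "finite H" using finite_cube by (rule finite_subset)
  then obtain s where s: "s \<in> cube n"
    "2 ^ n * card {xs \<in> permutations_of_set {1..n}. shifted_code n s xs \<in> H} \<le> fact n * card H"
    by (rule exists_good_shift)
  let ?T = "{xs \<in> permutations_of_set {1..n}. shifted_code n s xs \<in> H}"
  have "chain_cover n (n - d - 1) (prefixes ` ?T)"
    unfolding chain_cover_def
  proof (intro conjI ballI allI impI)
    fix C assume "C \<in> prefixes ` ?T"
    thus "subset.chain (boolean_lattice n) C" using prefixes_chain by auto
  next
    fix D assume "strict_chain n (n - d - 1) D"
    from strict_chain_covered_by_coded_permutation[OF assms H(1) s(1) this]
    show "\<exists>C\<in>prefixes ` ?T. D \<subseteq> C" by auto
  qed
  moreover have "card (prefixes ` ?T) \<le> card ?T" by (intro card_image_le) simp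
  hence "2 ^ n * card (prefixes ` ?T) \<le> fact n * card H"
    using s(2) by (meson le_trans mult_le_mono2)
  ultimately show ?thesis using that H(2) by simp
qed

lemma chain_cover_number_upper:
  assumes "d + 1 \<le> n"
  shows "real (chain_cover_number n (n - d - 1)) / fact n \<le> hitting_ratio d n"
proof -
  obtain \<C> where C: "chain_cover n (n - d - 1) \<C>"
      "2 ^ n * card \<C> \<le> fact n * subcube_hitting_number n d"
    using exists_economical_cover[OF assms] by blast
  have "chain_cover_number n (n - d - 1) \<le> card \<C>"
    unfolding chain_cover_number_def by (intro Least_le) (use C(1) in blast)
  hence "2 ^ n * chain_cover_number n (n - d - 1) \<le> fact n * subcube_hitting_number n d"
    using C(2) by (meson le_trans mult_le_mono2)
  hence "real (2 ^ n * chain_cover_number n (n - d - 1)) \<le> real (fact n * subcube_hitting_number n d)"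
    by (rule of_nat_mono)
  thus ?thesis unfolding hitting_ratio_def by (simp add: field_simps)
qed

section \<open>The lower bound\<close>

text \<open>The action of the cube on lists: the counter \<open>j\<close> is the coordinate that decides about the
  first two entries. For a list of odd length the last entry is never moved.\<close>

fun swap_pairs :: "(nat \<Rightarrow> nat) \<Rightarrow> nat \<Rightarrow> nat list \<Rightarrow> nat list" where
  "swap_pairs x j (a # b # xs) = (if x j = 1 then b # a # swap_pairs x (Suc j) xs
                                  else a # b # swap_pairs x (Suc j) xs)"
| "swap_pairs x j xs = xs"

lemma swap_pairs_involution: "swap_pairs x j (swap_pairs x j xs) = xs"
  by (induction x j xs rule: swap_pairs.induct) auto

lemma mset_swap_pairs [simp]: "mset (swap_pairs x j xs) = mset xs"
  by (induction x j xs rule: swap_pairs.induct) auto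

lemma swap_pairs_permutation:
  "swap_pairs x j xs \<in> permutations_of_set A \<longleftrightarrow> xs \<in> permutations_of_set A"
  unfolding permutations_of_set_def mem_Collect_eq
  by (metis mset_eq_imp_distinct_iff mset_eq_setD mset_swap_pairs)

lemma swap_pairs_cong:
  "(\<And>i. i \<in> {j..<j + length xs div 2} \<Longrightarrow> x i = y i) \<Longrightarrow> swap_pairs x j xs = swap_pairs y j xs"
  by (induction x j xs rule: swap_pairs.induct) auto

lemma set_take_even_swap_pairs:
  "set (take (2 * i) (swap_pairs x j xs)) = set (take (2 * i) xs)"
proof (induction x j xs arbitrary: i rule: swap_pairs.induct)
  case (1 x j a b xs)
  thus ?case by (cases i) auto
qed auto

text \<open>The even prefixes are the same along an orbit, and each odd prefix determines one coordinate.
  So the coordinates left free by a subcube correspond to the odd levels deleted from a chain.\<close>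

lemma swap_pairs_odd_prefix_determines:
  assumes "distinct xs" "x (j + i) < 2" "y (j + i) < 2" "i < length xs div 2"
    and "set (take (2 * i + 1) (swap_pairs x j xs)) = set (take (2 * i + 1) (swap_pairs y j xs))"
  shows "x (j + i) = y (j + i)"
  using assms
proof (induction x j xs arbitrary: i rule: swap_pairs.induct)
  case (1 x j a b xs)
  show ?case
  proof (cases i)
    case 0
    thus ?thesis using "1.prems" by (auto split: if_splits)
  next
    case (Suc k)
    have disj: "{a, b} \<inter> set (take (2 * k + 1) (swap_pairs z (Suc j) xs)) = {}" for z
      using "1.prems"(1) mset_eq_setD[OF mset_swap_pairs[of z "Suc j" xs]] 
      by (auto dest: in_set_takeD)
    have step: "set (take (2 * i + 1) (swap_pairs z j (a # b # xs)))
            = {a, b} \<union> set (take (2 * k + 1) (swap_pairs z (Suc j) xs))" for z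
      by (auto simp: Suc)
    have "set (take (2 * k + 1) (swap_pairs x (Suc j) xs)) = set (take (2 * k + 1) (swap_pairs y (Suc j) xs))"
      using "1.prems"(5) disj[of x] disj[of y] unfolding step by blast
    thus ?thesis using "1.IH" "1.prems"(1-4) Suc by (auto split: if_splits)
  qed
qed auto

lemma permutation_with_same_even_prefixes:
  assumes "distinct ys" "distinct xs" "set ys = set xs"
    and "\<And>i. set (take (2 * i) ys) = set (take (2 * i) xs)"
  shows "\<exists>x. (\<forall>i. x i < 2) \<and> ys = swap_pairs x j xs"
  using assms
proof (induction xs arbitrary: ys j rule: induct_list012)
  case 1
  thus ?case by (auto intro: exI[of _ "\<lambda>_. 0"])
next
  case (2 a)
  hence "length ys = 1" by (metis distinct_card length_Cons list.size(3) One_nat_def)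
  hence "ys = [a]" using 2 by (auto simp: length_Suc_conv)
  thus ?case by (auto intro: exI[of _ "\<lambda>_. 0"])
next
  case (3 a b xs)
  have "length ys = length (a # b # xs)" using 3 by (metis distinct_card)
  then obtain p q zs where ys: "ys = p # q # zs" by (auto simp: length_Suc_conv)
  have "{p, q} = {a, b}" using "3.prems"(4)[of 1] unfolding ys by (simp add: numeral_2_eq_2)
  have disj: "{a, b} \<inter> set zs = {}" "{a, b} \<inter> set xs = {}"
    using "3.prems"(1,2) \<open>{p, q} = {a, b}\<close> unfolding ys by auto
  have sets: "set zs = set xs" using "3.prems"(3) \<open>{p, q} = {a, b}\<close> disj unfolding ys by auto
  have "set (take (2 * i) zs) = set (take (2 * i) xs)" for i
  proof -
    have "{a, b} \<union> set (take (2 * i) zs) = {a, b} \<union> set (take (2 * i) xs)"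
      using "3.prems"(4)[of "Suc i"] \<open>{p, q} = {a, b}\<close> unfolding ys by auto
    moreover have "{a, b} \<inter> set (take (2 * i) zs) = {}" "{a, b} \<inter> set (take (2 * i) xs) = {}"
      using disj by (auto dest: in_set_takeD)
    ultimately show ?thesis by blast
  qed
  then obtain x where x: "\<forall>i. x i < 2" "zs = swap_pairs x (Suc j) xs"
    using "3.IH"(1)[of zs "Suc j"] "3.prems"(1,2) sets unfolding ys by auto
  define x' where "x' = x(j := if p = a then 0 else 1)"
  have "swap_pairs x' (Suc j) xs = zs"
    unfolding x(2) by (rule swap_pairs_cong) (auto simp: x'_def)
  moreover have "p = a \<and> q = b \<or> p = b \<and> q = a \<and> p \<noteq> a"
    using \<open>{p, q} = {a, b}\<close> "3.prems"(2) by (auto simp: doubleton_eq_iff)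
  ultimately have "ys = swap_pairs x' j (a # b # xs)" unfolding ys by (auto simp: x'_def)
  moreover have "\<forall>i. x' i < 2" using x(1) by (auto simp: x'_def)
  ultimately show ?case by blast
qed

text \<open>A subcube with free coordinates \<open>I\<close> through the point \<open>a\<close> corresponds to the chain of the
  permutation at \<open>a\<close> without the bottom, the top and the levels \<open>2 * i - 1\<close> for \<open>i \<in> I\<close>. A
  permutation that covers this chain has the even prefixes of the orbit, hence belongs to it, and
  agrees with \<open>a\<close> off \<open>I\<close> because the other odd levels are present.\<close>

lemma swap_orbit_hits_subcubes:
  assumes n: "d + 1 \<le> n" and xs: "xs \<in> permutations_of_set {1..n}"
    and cover: "\<And>D. strict_chain n (n - d - 1) D \<Longrightarrow> \<exists>ys\<in>T. D \<subseteq> prefixes ys"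
    and T: "T \<subseteq> permutations_of_set {1..n}"
  shows "hits_subcubes (n div 2) d {x \<in> cube (n div 2). swap_pairs x 1 xs \<in> T}"
  unfolding hits_subcubes_def
proof (intro conjI allI impI)
  let ?m = "n div 2"
  fix A assume "is_subcube ?m d A"
  then obtain I a where I: "I \<subseteq> {1..?m}" "card I = d" and a: "a \<in> cube ?m"
    and A: "A = {x \<in> cube ?m. \<forall>i\<in>{1..?m} - I. x i = a i}"
    unfolding is_subcube_def by blast
  define zs where "zs = swap_pairs a 1 xs"
  have zs: "zs \<in> permutations_of_set {1..n}" using xs by (simp add: zs_def swap_pairs_permutation)
  have dxs: "distinct xs" and sxs: "set xs = {1..n}" and lxs: "length xs = n"
    using permutations_of_setD[OF xs] distinct_card[of xs] by auto
  define J where "J = (\<lambda>i. 2 * i - 1) ` I"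
  have J: "J \<subseteq> {1..n - 1}" using I(1) n unfolding J_def by fastforce
  have "card J = d" unfolding J_def using I by (subst card_image) (force intro!: inj_onI)+
  hence "card ({1..n - 1} - J) = n - d - 1" using J by (subst card_Diff_subset) (auto intro: finite_subset)
  hence "strict_chain n (n - d - 1) ((\<lambda>k. set (take k zs)) ` ({1..n - 1} - J))"
    by (intro strict_chain_prefixes[OF zs]) auto
  then obtain ys where ys: "ys \<in> T" "(\<lambda>k. set (take k zs)) ` ({1..n - 1} - J) \<subseteq> prefixes ys"
    using cover by blast
  have dzs: "distinct zs" "set zs = {1..n}" "length zs = n"
    using permutations_of_setD[OF zs] distinct_card[of zs] by auto
  have dys: "distinct ys" "set ys = {1..n}" "length ys = n"
    using permutations_of_setD[of ys "{1..n}"] T ys(1) distinct_card[of ys] by auto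
  have agree: "set (take k ys) = set (take k zs)" if k: "k \<notin> J" for k
  proof (cases "k \<in> {1..n - 1}")
    case True
    hence "set (take k zs) \<in> prefixes ys" using ys(2) k by blast
    moreover have "card (set (take k zs)) = k" using True dzs by (subst distinct_card) auto
    ultimately show ?thesis using prefix_eq_take_card[OF dys(1)] by metis
  next
    case False
    hence "k = 0 \<or> k \<ge> n" by auto
    thus ?thesis using dys dzs by auto
  qed
  have "set (take (2 * i) ys) = set (take (2 * i) xs)" for i
  proof -
    have "2 * i \<noteq> 2 * k - 1" if "k \<in> I" for k
    proof -
      have "1 \<le> k" using that I(1) by auto
      thus ?thesis by presburger
    qed
    hence "2 * i \<notin> J" unfolding J_def by blast
    thus ?thesis using agree set_take_even_swap_pairs unfolding zs_def by metis
  qed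
  then obtain x where x: "\<forall>i. x i < 2" "ys = swap_pairs x 1 xs"
    using permutation_with_same_even_prefixes[OF dys(1) dxs, of 1] dys sxs by blast
  define x' where "x' = restrict x {1..?m}"
  have x': "x' \<in> cube ?m" unfolding x'_def using x(1) by (intro restrict_cube) auto
  have "swap_pairs x' 1 xs = ys"
    unfolding x(2) by (rule swap_pairs_cong) (auto simp: x'_def lxs)
  moreover have "x' i = a i" if i: "i \<in> {1..?m} - I" for i
  proof -
    have "2 * (i - 1) + 1 \<noteq> 2 * k - 1" if "k \<in> I" for k
      using i that by (cases "k = i"; cases i; cases k) auto
    hence "2 * (i - 1) + 1 \<notin> J" unfolding J_def by blast
    hence "set (take (2 * (i - 1) + 1) ys) = set (take (2 * (i - 1) + 1) zs)" by (rule agree)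
    hence "x (1 + (i - 1)) = a (1 + (i - 1))"
      unfolding x(2) zs_def using i x(1) cube_less_2[OF a, of i] lxs
      by (intro swap_pairs_odd_prefix_determines[OF dxs]) auto
    thus ?thesis using i by (simp add: x'_def)
  qed
  ultimately have "x' \<in> {x \<in> cube ?m. swap_pairs x 1 xs \<in> T} \<inter> A" using x' ys(1) A by auto
  thus "{x \<in> cube ?m. swap_pairs x 1 xs \<in> T} \<inter> A \<noteq> {}" by blast
qed auto

text \<open>Double counting of the pairs of a permutation and a point of the cube that moves it into
  the cover: for each permutation there are at least \<open>g(m, d)\<close> such points, and each point acts
  injectively.\<close>

lemma chain_cover_lower:
  assumes n: "d + 1 \<le> n" and C: "chain_cover n (n - d - 1) \<C>"
  shows "fact n * subcube_hitting_number (n div 2) d \<le> 2 ^ (n div 2) * card \<C>"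
proof -
  let ?m = "n div 2" and ?P = "permutations_of_set {1..n}"
  have "\<exists>xs. xs \<in> ?P \<and> C \<subseteq> prefixes xs" if "C \<in> \<C>" for C
    using C that chain_extends_to_permutation unfolding chain_cover_def by metis
  then obtain e where e: "\<And>C. C \<in> \<C> \<Longrightarrow> e C \<in> ?P" "\<And>C. C \<in> \<C> \<Longrightarrow> C \<subseteq> prefixes (e C)" by metis
  have "\<C> \<subseteq> Pow (Pow {1..n})"
    using C unfolding chain_cover_def subset_chain_def boolean_lattice_def by blast
  hence "finite \<C>" by (rule finite_subset) simp
  define T where "T = e ` \<C>"
  have T: "T \<subseteq> ?P" using e(1) unfolding T_def by blast
  have finT: "finite T" using T by (rule finite_subset) simp
  have covT: "\<exists>ys\<in>T. D \<subseteq> prefixes ys" if "strict_chain n (n - d - 1) D" for D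
  proof -
    obtain C where "C \<in> \<C>" "D \<subseteq> C" using C \<open>strict_chain n (n - d - 1) D\<close> unfolding chain_cover_def by blast
    thus ?thesis using e(2)[of C] unfolding T_def by auto
  qed
  have "fact n * subcube_hitting_number ?m d = (\<Sum>xs\<in>?P. subcube_hitting_number ?m d)" by simp
  also have "\<dots> \<le> (\<Sum>xs\<in>?P. card {x \<in> cube ?m. swap_pairs x 1 xs \<in> T})"
    by (intro sum_mono subcube_hitting_number_le swap_orbit_hits_subcubes[OF n _ covT T])
  also have "\<dots> = (\<Sum>x\<in>cube ?m. card {xs \<in> ?P. swap_pairs x 1 xs \<in> T})"
    by (rule sum_card_swap[symmetric]) (auto simp: finite_cube)
  also have "\<dots> \<le> (\<Sum>x\<in>cube ?m. card T)"
  proof (rule sum_mono)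
    fix x
    have "inj (swap_pairs x 1)" by (metis injI swap_pairs_involution)
    thus "card {xs \<in> ?P. swap_pairs x 1 xs \<in> T} \<le> card T"
      using finT by (intro card_inj_on_le[of "swap_pairs x 1"]) (auto intro: inj_on_subset)
  qed
  also have "\<dots> = 2 ^ ?m * card T" by (simp add: card_cube)
  also have "\<dots> \<le> 2 ^ ?m * card \<C>" using card_image_le[OF \<open>finite \<C>\<close>] unfolding T_def by simp
  finally show ?thesis .
qed

lemma chain_cover_number_lower:
  assumes n: "d + 1 \<le> n"
  shows "hitting_ratio d (n div 2) \<le> real (chain_cover_number n (n - d - 1)) / fact n"
proof -
  have "\<exists>k \<C>. chain_cover n (n - d - 1) \<C> \<and> card \<C> = k"
    using exists_economical_cover[OF n] by metis
  from LeastI_ex[OF this] obtain \<C> where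
    C: "chain_cover n (n - d - 1) \<C>" "card \<C> = chain_cover_number n (n - d - 1)"
    unfolding chain_cover_number_def by blast
  have "real (fact n * subcube_hitting_number (n div 2) d) \<le> real (2 ^ (n div 2) * card \<C>)"
    using chain_cover_lower[OF n C(1)] by (rule of_nat_mono)
  thus ?thesis unfolding hitting_ratio_def C(2) by (simp add: field_simps)
qed

section \<open>Asymptotics\<close>

lemma chain_cover_number_asymptotics:
  assumes conv: "convergent (hitting_ratio d)"
  shows "\<exists>\<epsilon> :: nat \<Rightarrow> real. \<epsilon> \<in> o(\<lambda>_. 1) \<and>
    (\<forall>n. real (chain_cover_number n (n - d - 1)) = (hitting_density d + \<epsilon> n) * fact n)"
proof -
  define \<rho> where "\<rho> n = real (chain_cover_number n (n - d - 1)) / fact n" for n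
  have lim: "hitting_ratio d \<longlonglongrightarrow> hitting_density d"
    using conv unfolding hitting_density_def by (simp add: convergent_LIMSEQ_iff)
  have "filterlim (\<lambda>n::nat. n div 2) at_top sequentially"
    by (rule filterlim_at_top_div_const_nat) simp
  hence lim_half: "(\<lambda>n. hitting_ratio d (n div 2)) \<longlonglongrightarrow> hitting_density d"
    by (rule filterlim_compose[OF lim])
  have lower: "\<forall>\<^sub>F n in sequentially. hitting_ratio d (n div 2) \<le> \<rho> n"
    unfolding \<rho>_def using eventually_ge_at_top[of "d + 1"]
    by eventually_elim (rule chain_cover_number_lower)
  have upper: "\<forall>\<^sub>F n in sequentially. \<rho> n \<le> hitting_ratio d n"
    unfolding \<rho>_def using eventually_ge_at_top[of "d + 1"]
    by eventually_elim (rule chain_cover_number_upper)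
  have "\<rho> \<longlonglongrightarrow> hitting_density d"
    by (rule tendsto_sandwich[OF lower upper lim_half lim])
  hence "(\<lambda>n. \<rho> n - hitting_density d) \<in> o(\<lambda>_. 1)"
    by (intro smalloI_tendsto) (auto simp: LIM_zero_iff)
  thus ?thesis
    by (intro exI[of _ "\<lambda>n. \<rho> n - hitting_density d"]) (auto simp: \<rho>_def)
qed

theorem theorem1p5:
  shows "(\<forall>d::nat. d \<ge> 1 \<longrightarrow> convergent (hitting_ratio d) \<longrightarrow>
      (\<exists>\<epsilon> :: nat \<Rightarrow> real. \<epsilon> \<in> o(\<lambda>_. 1) \<and>
        (\<forall>n \<ge> d + 2. real (chain_cover_number n (n - d - 1)) = (hitting_density d + \<epsilon> n) * fact n)))
    \<and> (\<forall>t::nat. t \<ge> 2 \<longrightarrow> convergent (hitting_ratio (t - 1)) \<longrightarrow>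
      (\<exists>\<epsilon> :: nat \<Rightarrow> real. \<epsilon> \<in> o(\<lambda>_. 1) \<and>
        (\<forall>n \<ge> t + 1. real (chain_cover_number n (n - t)) = (hitting_density (t - 1) + \<epsilon> n) * fact n)))"
proof (intro conjI allI impI)
  fix d :: nat assume "convergent (hitting_ratio d)"
  thus "\<exists>\<epsilon> :: nat \<Rightarrow> real. \<epsilon> \<in> o(\<lambda>_. 1) \<and>
        (\<forall>n \<ge> d + 2. real (chain_cover_number n (n - d - 1)) = (hitting_density d + \<epsilon> n) * fact n)"
    using chain_cover_number_asymptotics by blast
next
  fix t :: nat assume t: "t \<ge> 2" and "convergent (hitting_ratio (t - 1))"
  have "n - (t - 1) - 1 = n - t" for n using t by simp
  thus "\<exists>\<epsilon> :: nat \<Rightarrow> real. \<epsilon> \<in> o(\<lambda>_. 1) \<and>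
        (\<forall>n \<ge> t + 1. real (chain_cover_number n (n - t)) = (hitting_density (t - 1) + \<epsilon> n) * fact n)"
    using chain_cover_number_asymptotics[OF \<open>convergent (hitting_ratio (t - 1))\<close>] by metis
qed

end
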